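(* Let $\mathbb{K}=\bigcup_{m\ge 1}\mathbb{R}((t^{1/m}))$, let $F\in\mathbb{K}[x_1,\ldots,x_n]$ be a nonzero polynomial and let $f=trop(F)$ be the corresponding real tropical polynomial. Assume that the subdivision of the support $Supp(F)$ that is dual to $f$ is a triangulation that contains all the monomials in $Supp(F)$ as vertices. Then $\{F\}$ is a real tropical basis of the ideal $(F)$, that is, $\mathcal{T}_{\mathbb{R}}(F)=trop(\mathcal{V}(F))$.
   Context: $\mathbb{K}$ is the real closed field of real Puiseux series; the valuation $v(x)\in\mathbb{Q}$ of $x\in\mathbb{K}^*$ is the least exponent of $t$ occurring in $x$, and $x>0$ iff the coefficient of its least-exponent term is positive. Put $\mathbb{TR}=\{1,-1\}\times\mathbb{R}$ (with the product topology) and $trop:\mathbb{K}^*\to\mathbb{TR}$, $trop(x)=(s(x),v(x))$ with $s(x)=\pm1$ the sign of $x$; $trop$ is applied component-wise on $(\mathbb{K}^* )^n$. For $a=(\sigma,\alpha)\in\mathbb{TR}$ write $s(a)=\sigma$ and $|a|=\alpha$; for $p\in\mathbb{TR}^n$, $|p|=(|p_1|,\ldots,|p_n|)$. $\mathcal{V}(F)$ is the set of zeros of $F$ with coordinates in $\mathbb{K}$, and $trop(\mathcal{V}(F))$ denotes the closure in $\mathbb{TR}^n$ of the image under $trop$ of $\mathcal{V}(F)\cap(\mathbb{K}^* )^n$. For $F=\sum_{\ell\in A}a_\ell x^\ell$ with support $A=Supp(F)$ (all $a_\ell\ne0$), $trop(F)=\bigoplus_{\ell\in A}(s(a_\ell),v(a_\ell))w^\ell$,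 and $\mathcal{T}_{\mathbb{R}}(F)\subseteq\mathbb{TR}^n$ is the set of points $p$ for which there are two exponents $i\neq j$ in $A$, both attaining $\min_{\ell\in A}\big(v(a_\ell)+\langle \ell,|p|\rangle\big)$, such that $s(a_i)\prod_{k=1}^n s(p_k)^{i_k}=1$ and $s(a_j)\prod_{k=1}^n s(p_k)^{j_k}=-1$. The subdivision dual to $f$: for $w\in\mathbb{R}^n$ let $A_w\subseteq A$ be the set of exponents attaining $\min_{\ell\in A}(v(a_\ell)+\langle\ell,w\rangle)$; the cells of the subdivision (of the convex hull of $A$) are the sets $A_w$ and their faces (i.e. it is the regular subdivision obtained from the lower hull of the points $(\ell,v(a_\ell))$). It is a triangulation containing all monomials as vertices if every cell is the set of vertices of a simplex (affinely independent) and each $\ell\in A$ is a vertex of the subdivision. A real tropical basis of an ideal $I$ is a finite set $\{F_1,\ldots,F_r\}$ generating $I$ such that $trop(\mathcal{V}(I))=\bigcap_{i=1}^r\mathcal{T}_{\mathbb{R}}(F_i)$. *)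

theory Defs
  imports
    "HOL-Analysis.Analysis"
    "HOL-Computational_Algebra.Formal_Laurent_Series"
    "HOL-Library.Poly_Mapping"
begin

unbundle fps_syntax

section \<open>The ordered field of real Puiseux series\<close>

text \<open>\<open>ramify m f\<close> is the coefficient function of \<open>f(t^(1/m))\<close>: the coefficient of
  \<open>t^q\<close> is the \<open>(q * m)\<close>-th coefficient of \<open>f\<close> if \<open>q * m\<close> is an integer, and \<open>0\<close> otherwise.\<close>

definition ramify :: "nat \<Rightarrow> real fls \<Rightarrow> rat \<Rightarrow> real" where
  "ramify m f = (\<lambda>q. if q * of_nat m \<in> \<int> then f $$ \<lfloor>q * of_nat m\<rfloor> else 0)"

typedef puiseux = "\<Union>m\<in>{1::nat..}. range (ramify m)"
  morphisms pcoeff Abs_puiseux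
  by force

setup_lifting type_definition_puiseux

lemma puiseux_eqI: "(\<And>q. pcoeff x q = pcoeff y q) \<Longrightarrow> x = y"
  by (metis ext pcoeff_inject)

subsection \<open>Auxiliary facts on ramification\<close>

lemma ramify_of_int [simp]: "m > 0 \<Longrightarrow> ramify m f (of_int k / of_nat m) = f $$ k"
  by (simp add: ramify_def)

lemma ramify_nonzeroD:
  assumes "m > 0" "ramify m f q \<noteq> 0"
  obtains k where "q = of_int k / of_nat m" "f $$ k \<noteq> 0"
proof -
  from assms have "q * of_nat m \<in> \<int>" by (auto simp: ramify_def split: if_splits)
  then obtain k where k: "q * of_nat m = of_int k" by (elim Ints_cases)
  with assms have "q = of_int k / of_nat m" by (simp add: field_simps)
  with that[of k] assms show ?thesis by (simp add: ramify_def)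
qed

lemma ramify_inj: "m > 0 \<Longrightarrow> ramify m f = ramify m g \<Longrightarrow> f = g"
  by (metis fls_eqI ramify_of_int)

lemma ramify_refine:
  assumes "m > 0" "d > 0"
  shows "ramify m f = ramify (m * d) (fls_compose_power f d)"
proof
  fix q
  show "ramify m f q = ramify (m * d) (fls_compose_power f d) q"
  proof (cases "q * of_nat m \<in> \<int>")
    case True
    then obtain k where k: "q * of_nat m = of_int k" by (elim Ints_cases)
    hence "q * of_nat (m * d) = of_int (k * int d)" by (simp add: mult.assoc[symmetric])
    with k assms show ?thesis
      unfolding ramify_def by (simp only: Ints_of_int if_True floor_of_int) (simp add: fls_nth_compose_power)
  next
    case False
    have "fls_compose_power f d $$ \<lfloor>q * of_nat (m * d)\<rfloor> = 0" if "q * of_nat (m * d) \<in> \<int>"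
    proof -
      from that obtain l where l: "q * of_nat (m * d) = of_int l" by (elim Ints_cases)
      have "\<not> int d dvd l"
      proof
        assume "int d dvd l"
        then obtain k where "l = int d * k" by blast
        with l assms have "q * of_nat m = of_int k" by (simp add: field_simps)
        with False show False by simp
      qed
      with l assms show ?thesis by (simp only: floor_of_int) (simp add: fls_nth_compose_power)
    qed
    with False show ?thesis by (simp add: ramify_def)
  qed
qed

lemma puiseux_common1:
  obtains m f where "m > 0" "pcoeff x = ramify m f"
proof -
  obtain m f where "m \<in> {1::nat..}" "pcoeff x = ramify m f"
    using pcoeff[of x] by (elim UN_E rangeE)
  with that[of m f] show ?thesis by simp
qed

lemma puiseux_common2:
  obtains m f g where "m > 0" "pcoeff x = ramify m f" "pcoeff y = ramify m g"
proof -
  obtain m f where 1: "m > 0" "pcoeff x = ramify m f" by (rule puiseux_common1)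
  obtain n g where 2: "n > 0" "pcoeff y = ramify n g" by (rule puiseux_common1)
  show ?thesis
  proof (rule that)
    show "m * n > 0" using 1 2 by simp
    show "pcoeff x = ramify (m * n) (fls_compose_power f n)"
      unfolding 1 by (rule ramify_refine[OF 1(1) 2(1)])
    show "pcoeff y = ramify (m * n) (fls_compose_power g m)"
      unfolding 2 mult.commute[of m n] by (rule ramify_refine[OF 2(1) 1(1)])
  qed
qed

lemma puiseux_common3:
  obtains m f g h where "m > 0" "pcoeff x = ramify m f" "pcoeff y = ramify m g"
    "pcoeff z = ramify m h"
proof -
  obtain m f g where 1: "m > 0" "pcoeff x = ramify m f" "pcoeff y = ramify m g"
    by (rule puiseux_common2)
  obtain n h where 2: "n > 0" "pcoeff z = ramify n h" by (rule puiseux_common1)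
  show ?thesis
  proof (rule that)
    show "m * n > 0" using 1 2 by simp
    show "pcoeff x = ramify (m * n) (fls_compose_power f n)"
      unfolding 1 by (rule ramify_refine[OF 1(1) 2(1)])
    show "pcoeff y = ramify (m * n) (fls_compose_power g n)"
      unfolding 1 by (rule ramify_refine[OF 1(1) 2(1)])
    show "pcoeff z = ramify (m * n) (fls_compose_power h m)"
      unfolding 2 mult.commute[of m n] by (rule ramify_refine[OF 2(1) 1(1)])
  qed
qed

lemma ramify_in: "m > 0 \<Longrightarrow> ramify m f \<in> (\<Union>m\<in>{1::nat..}. range (ramify m))"
  by (rule UN_I[of m]) simp_all

lemma ramify_add: "(\<lambda>q. ramify m f q + ramify m g q) = ramify m (f + g)"
  by (auto simp: ramify_def fun_eq_iff)

lemma ramify_diff: "(\<lambda>q. ramify m f q - ramify m g q) = ramify m (f - g)"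
  by (auto simp: ramify_def fun_eq_iff)

lemma ramify_uminus: "(\<lambda>q. - ramify m f q) = ramify m (- f)"
  by (auto simp: ramify_def fun_eq_iff)

lemma ramify_0: "ramify m 0 = (\<lambda>_. 0)"
  by (auto simp: ramify_def fun_eq_iff)

lemma ramify_1: "m > 0 \<Longrightarrow> ramify m 1 = (\<lambda>q. if q = 0 then 1 else 0)"
proof
  fix q :: rat assume m: "m > 0"
  have "\<lfloor>q * of_nat m\<rfloor> = 0 \<longleftrightarrow> q = 0" if "q * of_nat m \<in> \<int>"
    using that m by (auto elim!: Ints_cases)
  with m show "ramify m 1 q = (if q = 0 then 1 else 0)"
    by (auto simp: ramify_def)
qed

text \<open>The sum below is finite, since both supports are bounded below with bounded denominators.\<close>

definition conv :: "(rat \<Rightarrow> real) \<Rightarrow> (rat \<Rightarrow> real) \<Rightarrow> rat \<Rightarrow> real" where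
  "conv a b = (\<lambda>q. \<Sum>r | a r \<noteq> 0 \<and> b (q - r) \<noteq> 0. a r * b (q - r))"

lemma ramify_mult:
  assumes m: "m > 0"
  shows "conv (ramify m f) (ramify m g) = ramify m (f * g)"
proof
  fix q
  let ?S = "{r. ramify m f r \<noteq> 0 \<and> ramify m g (q - r) \<noteq> 0}"
  show "conv (ramify m f) (ramify m g) q = ramify m (f * g) q"
  proof (cases "q * of_nat m \<in> \<int>")
    case False
    have "?S = {}"
    proof (rule ccontr)
      assume "?S \<noteq> {}"
      then obtain r where r: "ramify m f r \<noteq> 0" "ramify m g (q - r) \<noteq> 0" by auto
      then obtain k l where k: "r = of_int k / of_nat m" and "q - r = of_int l / of_nat m"
        using m by (meson ramify_nonzeroD)
      hence "q * of_nat m = of_int (k + l)" using m by (simp add: field_simps)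
      thus False using False by (metis Ints_of_int)
    qed
    hence "conv (ramify m f) (ramify m g) q = 0"
      unfolding conv_def by (simp only: sum.empty)
    thus ?thesis using False by (simp add: ramify_def)
  next
    case True
    then obtain n where n: "q * of_nat m = of_int n" by (elim Ints_cases)
    hence q: "q = of_int n / of_nat m" using m by (simp add: field_simps)
    let ?T = "{k. f $$ k \<noteq> 0 \<and> g $$ (n - k) \<noteq> 0}"
    let ?I = "{fls_subdegree f..n - fls_subdegree g}"
    have diff: "q - of_int k / of_nat m = of_int (n - k) / of_nat m" for k
      by (simp add: q diff_divide_distrib)
    have T: "?T \<subseteq> ?I"
      using fls_subdegree_leI by force
    have S: "?S = (\<lambda>k. of_int k / of_nat m) ` ?T"
    proof (intro equalityI subsetI)
      fix r assume r: "r \<in> ?S"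
      then obtain k where k: "r = of_int k / of_nat m" "f $$ k \<noteq> 0"
        using m by (blast elim: ramify_nonzeroD)
      with r m have "g $$ (n - k) \<noteq> 0" by (simp only: mem_Collect_eq diff ramify_of_int) simp
      with k show "r \<in> (\<lambda>k. of_int k / of_nat m) ` ?T" by blast
    next
      fix r :: rat assume "r \<in> (\<lambda>k. of_int k / of_nat m) ` ?T"
      then show "r \<in> ?S" using m by (auto simp only: mem_Collect_eq diff ramify_of_int)
    qed
    have inj: "inj_on (\<lambda>k. of_int k / of_nat m :: rat) ?T"
      using m by (auto intro!: inj_onI)
    have "conv (ramify m f) (ramify m g) q = (\<Sum>k\<in>?T. f $$ k * g $$ (n - k))"
      unfolding conv_def S sum.reindex[OF inj] o_def diff using m by (simp only: ramify_of_int)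
    also have "\<dots> = (\<Sum>k\<in>?I. f $$ k * g $$ (n - k))"
      by (rule sum.mono_neutral_left) (use T in auto)
    also have "\<dots> = (f * g) $$ n" by (simp add: fls_times_nth(2))
    also have "\<dots> = ramify m (f * g) q" using m q by simp
    finally show ?thesis .
  qed
qed

lemma puiseux_set_binop:
  assumes "a \<in> (\<Union>m\<in>{1::nat..}. range (ramify m))" "b \<in> (\<Union>m\<in>{1::nat..}. range (ramify m))"
    and "\<And>m f g. m > 0 \<Longrightarrow> op (ramify m f) (ramify m g) \<in> (\<Union>m\<in>{1::nat..}. range (ramify m))"
  shows "op a b \<in> (\<Union>m\<in>{1::nat..}. range (ramify m))"
proof -
  obtain m f g where "m > 0" "pcoeff (Abs_puiseux a) = ramify m f"
    "pcoeff (Abs_puiseux b) = ramify m g" by (rule puiseux_common2)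
  with assms show ?thesis by (simp only: Abs_puiseux_inverse)
qed

subsection \<open>Field structure\<close>

instantiation puiseux :: comm_ring_1
begin

lift_definition zero_puiseux :: puiseux is "\<lambda>_. 0"
  by (rule ramify_in[OF zero_less_one, of 0, unfolded ramify_0])

lift_definition one_puiseux :: puiseux is "\<lambda>q. if q = 0 then 1 else 0"
  by (rule ramify_in[OF zero_less_one, of 1, unfolded ramify_1[OF zero_less_one]])

lift_definition plus_puiseux :: "puiseux \<Rightarrow> puiseux \<Rightarrow> puiseux" is "\<lambda>a b q. a q + b q"
  by (erule (1) puiseux_set_binop) (simp only: ramify_add ramify_in)

lift_definition minus_puiseux :: "puiseux \<Rightarrow> puiseux \<Rightarrow> puiseux" is "\<lambda>a b q. a q - b q"
  by (erule (1) puiseux_set_binop) (simp only: ramify_diff ramify_in)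

lift_definition uminus_puiseux :: "puiseux \<Rightarrow> puiseux" is "\<lambda>a q. - a q"
  by (rule puiseux_set_binop[where op = "\<lambda>a _ q. - a q"], assumption, assumption)
    (simp only: ramify_uminus ramify_in)

lift_definition times_puiseux :: "puiseux \<Rightarrow> puiseux \<Rightarrow> puiseux" is conv
  by (erule (1) puiseux_set_binop) (simp only: ramify_mult ramify_in)

lemma pcoeff_ramify_add:
  "pcoeff x = ramify m f \<Longrightarrow> pcoeff y = ramify m g \<Longrightarrow> pcoeff (x + y) = ramify m (f + g)"
  by (simp add: plus_puiseux.rep_eq ramify_add)

lemma pcoeff_ramify_diff:
  "pcoeff x = ramify m f \<Longrightarrow> pcoeff y = ramify m g \<Longrightarrow> pcoeff (x - y) = ramify m (f - g)"
  by (simp add: minus_puiseux.rep_eq ramify_diff)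

lemma pcoeff_ramify_mult:
  "m > 0 \<Longrightarrow> pcoeff x = ramify m f \<Longrightarrow> pcoeff y = ramify m g \<Longrightarrow>
    pcoeff (x * y) = ramify m (f * g)"
  by (simp add: times_puiseux.rep_eq ramify_mult)

lemma pcoeff_ramify_1: "m > 0 \<Longrightarrow> pcoeff 1 = ramify m 1"
  by (simp add: one_puiseux.rep_eq ramify_1)

instance
proof
  fix a b c :: puiseux
  obtain m f g h where m: "m > 0" and a: "pcoeff a = ramify m f" and b: "pcoeff b = ramify m g"
    and c: "pcoeff c = ramify m h" by (rule puiseux_common3)
  note rs = pcoeff_inject[symmetric] pcoeff_ramify_mult[OF m] pcoeff_ramify_add
    pcoeff_ramify_1[OF m] a b c
  show "a * b * c = a * (b * c)" by (simp only: rs mult.assoc)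
  show "a * b = b * a" by (simp only: rs mult.commute)
  show "1 * a = a" by (simp only: rs mult_1)
  show "(a + b) * c = a * c + b * c" by (simp only: rs distrib_right)
  show "a + b + c = a + (b + c)" by (simp only: rs add.assoc)
  show "a + b = b + a" by (simp only: rs add.commute)
  show "0 + a = a" by (rule puiseux_eqI) (simp add: plus_puiseux.rep_eq zero_puiseux.rep_eq)
  show "- a + a = 0"
    by (rule puiseux_eqI)
      (simp add: plus_puiseux.rep_eq zero_puiseux.rep_eq uminus_puiseux.rep_eq)
  show "a - b = a + - b"
    by (rule puiseux_eqI)
      (simp add: plus_puiseux.rep_eq minus_puiseux.rep_eq uminus_puiseux.rep_eq)
  show "(0::puiseux) \<noteq> 1"
    by (auto simp: pcoeff_inject[symmetric] zero_puiseux.rep_eq one_puiseux.rep_eq fun_eq_iff)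
qed

end

lemma pcoeff_ramify_eq_0_iff: "m > 0 \<Longrightarrow> pcoeff x = ramify m f \<Longrightarrow> x = 0 \<longleftrightarrow> f = 0"
  using ramify_inj[of m f 0]
  by (auto simp: pcoeff_inject[symmetric] ramify_0 zero_puiseux.rep_eq)

lemma puiseux_inverse_exists:
  assumes "(x::puiseux) \<noteq> 0"
  obtains y where "x * y = 1"
proof -
  obtain m f where m: "m > 0" and x: "pcoeff x = ramify m f" by (rule puiseux_common1)
  have f: "f \<noteq> 0" using assms pcoeff_ramify_eq_0_iff[OF m x] by simp
  define y where "y = Abs_puiseux (ramify m (inverse f))"
  have y: "pcoeff y = ramify m (inverse f)"
    unfolding y_def using Abs_puiseux_inverse ramify_in[OF m] by blast
  have "pcoeff (x * y) = pcoeff 1"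
    using f by (simp add: pcoeff_ramify_mult[OF m x y] pcoeff_ramify_1[OF m])
  thus ?thesis using that pcoeff_inject by blast
qed

instantiation puiseux :: field
begin

definition inverse_puiseux :: "puiseux \<Rightarrow> puiseux" where
  "inverse_puiseux x = (if x = 0 then 0 else (SOME y. x * y = 1))"

definition divide_puiseux :: "puiseux \<Rightarrow> puiseux \<Rightarrow> puiseux" where
  "divide_puiseux x y = x * inverse y"

instance
proof
  fix a :: puiseux assume a: "a \<noteq> 0"
  have "a * (SOME y. a * y = 1) = 1"
    by (rule someI_ex) (use puiseux_inverse_exists[OF a] in blast)
  with a show "inverse a * a = 1" by (simp add: inverse_puiseux_def mult.commute)
qed (simp_all add: inverse_puiseux_def divide_puiseux_def)

end

subsection \<open>Valuation and order\<close>

text \<open>The valuation is only meaningful for nonzero series.\<close>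

definition pval :: "puiseux \<Rightarrow> rat" where
  "pval x = (LEAST q. pcoeff x q \<noteq> 0)"

definition pleading :: "puiseux \<Rightarrow> real" where
  "pleading x = pcoeff x (pval x)"

lemma pval_ramify:
  assumes m: "m > 0" and x: "pcoeff x = ramify m f" and f: "f \<noteq> 0"
  shows "pval x = of_int (fls_subdegree f) / of_nat m"
  unfolding pval_def
proof (rule Least_equality)
  show "pcoeff x (of_int (fls_subdegree f) / of_nat m) \<noteq> 0" using m f by (simp add: x)
next
  fix q assume "pcoeff x q \<noteq> 0"
  then obtain k where k: "q = of_int k / of_nat m" "f $$ k \<noteq> 0"
    using m x by (metis ramify_nonzeroD)
  hence "fls_subdegree f \<le> k" by (simp add: fls_subdegree_leI)
  with k m show "of_int (fls_subdegree f) / of_nat m \<le> q" by (simp add: divide_right_mono)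
qed

lemma pleading_ramify:
  assumes m: "m > 0" and x: "pcoeff x = ramify m f"
  shows "pleading x = f $$ fls_subdegree f"
proof (cases "f = 0")
  case True
  with m x show ?thesis by (simp add: pleading_def ramify_0)
next
  case False
  thus ?thesis using m x by (simp add: pleading_def pval_ramify[OF m x])
qed

lemma pleading_0 [simp]: "pleading 0 = 0"
  by (simp add: pleading_def zero_puiseux.rep_eq)

lemma pleading_eq_0_iff: "pleading x = 0 \<longleftrightarrow> x = 0"
proof -
  obtain m f where m: "m > 0" and x: "pcoeff x = ramify m f" by (rule puiseux_common1)
  show ?thesis
    using pcoeff_ramify_eq_0_iff[OF m x] pleading_ramify[OF m x] nth_fls_subdegree_zero_iff by metis
qed

lemma pleading_mult: "pleading (x * y) = pleading x * pleading y"
proof -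
  obtain m f g where m: "m > 0" and x: "pcoeff x = ramify m f" and y: "pcoeff y = ramify m g"
    by (rule puiseux_common2)
  show ?thesis
    unfolding pleading_ramify[OF m x] pleading_ramify[OF m y]
      pleading_ramify[OF m pcoeff_ramify_mult[OF m x y]]
    by (cases "f = 0 \<or> g = 0") (auto simp: fls_times_nth(1))
qed

lemma pleading_uminus: "pleading (- x) = - pleading x"
  by (simp add: pleading_def pval_def uminus_puiseux.rep_eq)

lemma pleading_add_pos:
  assumes "pleading x > 0" "pleading y > 0"
  shows "pleading (x + y) > 0"
proof -
  obtain m f g where m: "m > 0" and x: "pcoeff x = ramify m f" and y: "pcoeff y = ramify m g"
    by (rule puiseux_common2)
  define d where "d = min (fls_subdegree f) (fls_subdegree g)"
  have pos: "f $$ fls_subdegree f > 0" "g $$ fls_subdegree g > 0"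
    using assms by (simp_all add: pleading_ramify[OF m x] pleading_ramify[OF m y])
  have "f $$ d \<ge> 0"
    using pos by (cases "d = fls_subdegree f") (auto simp: d_def min_def split: if_splits)
  moreover have "g $$ d \<ge> 0"
    using pos by (cases "d = fls_subdegree g") (auto simp: d_def min_def split: if_splits)
  moreover have "f $$ d > 0 \<or> g $$ d > 0"
    using pos by (auto simp: d_def min_def)
  ultimately have "(f + g) $$ d > 0" by auto
  moreover from this have "fls_subdegree (f + g) = d"
    by (intro fls_subdegree_eqI) (auto simp: d_def)
  ultimately show ?thesis
    by (simp only: pleading_ramify[OF m pcoeff_ramify_add[OF x y]])
qed

instantiation puiseux :: linordered_field
begin

definition less_puiseux :: "puiseux \<Rightarrow> puiseux \<Rightarrow> bool" where
  "less_puiseux x y \<longleftrightarrow> pleading (y - x) > 0"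

definition less_eq_puiseux :: "puiseux \<Rightarrow> puiseux \<Rightarrow> bool" where
  "less_eq_puiseux x y \<longleftrightarrow> x = y \<or> x < y"

definition abs_puiseux :: "puiseux \<Rightarrow> puiseux" where
  "abs_puiseux x = (if x < 0 then - x else x)"

definition sgn_puiseux :: "puiseux \<Rightarrow> puiseux" where
  "sgn_puiseux x = (if x = 0 then 0 else if 0 < x then 1 else - 1)"

instance
proof
  fix x y z :: puiseux
  have flip: "pleading (x - y) = - pleading (y - x)"
    using pleading_uminus[of "y - x"] by simp
  have trans: "x < z" if "x < y" "y < z" for x y z :: puiseux
    using pleading_add_pos[of "y - x" "z - y"] that by (simp add: less_puiseux_def)
  have irrefl: "\<not> x < x" for x :: puiseux by (simp add: less_puiseux_def)
  show "x < y \<longleftrightarrow> x \<le> y \<and> \<not> y \<le> x"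
    using trans irrefl by (metis less_eq_puiseux_def)
  show "x \<le> x" by (simp add: less_eq_puiseux_def)
  show "x \<le> z" if "x \<le> y" "y \<le> z"
    using that trans by (metis less_eq_puiseux_def)
  show "x = y" if "x \<le> y" "y \<le> x"
    using that trans irrefl by (metis less_eq_puiseux_def)
  show "x \<le> y \<or> y \<le> x"
    using flip pleading_eq_0_iff[of "y - x"]
    by (auto simp: less_eq_puiseux_def less_puiseux_def)
  show "z + x \<le> z + y" if "x \<le> y"
    using that by (auto simp: less_eq_puiseux_def less_puiseux_def)
  show "z * x < z * y" if "x < y" "0 < z"
    using that pleading_mult[of z "y - x"] by (simp add: less_puiseux_def right_diff_distrib)
qed (simp_all add: abs_puiseux_def sgn_puiseux_def)

end

lemma puiseux_pos_iff: "0 < x \<longleftrightarrow> pleading x > 0"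
  by (simp add: less_puiseux_def)


section \<open>Multivariate polynomials over the Puiseux series\<close>

text \<open>Exponent vectors are finitely supported maps from the finite index type \<open>'n\<close> of
  variables to \<open>nat\<close>; the support of a polynomial is its set of \<open>keys\<close>.\<close>

type_synonym 'n pmpoly = "('n \<Rightarrow>\<^sub>0 nat) \<Rightarrow>\<^sub>0 puiseux"

definition mpoly_eval :: "'n::finite pmpoly \<Rightarrow> puiseux ^ 'n \<Rightarrow> puiseux" where
  "mpoly_eval F x =
    (\<Sum>l\<in>Poly_Mapping.keys F. Poly_Mapping.lookup F l * (\<Prod>k\<in>UNIV. (x $ k) ^ Poly_Mapping.lookup l k))"

definition zero_locus :: "'n::finite pmpoly set \<Rightarrow> (puiseux ^ 'n) set" where
  "zero_locus S = {x. \<forall>F\<in>S. mpoly_eval F x = 0}"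

text \<open>A ring is a module over itself by left multiplication; its submodules are its ideals.\<close>

lemma module_mult: "module ((*) :: 'a::comm_ring_1 \<Rightarrow> 'a \<Rightarrow> 'a)"
  by unfold_locales (simp_all add: algebra_simps)

definition ideal_gen :: "'a::comm_ring_1 set \<Rightarrow> 'a set" where
  "ideal_gen S = module.span (*) S"


section \<open>Real tropical geometry\<close>

text \<open>A pair \<open>(s, a)\<close> stands for an element of the set \<open>TR = {1, -1} \<times> \<real>\<close>. Integers carry the discrete
  topology in the library, so \<open>TR\<close> and \<open>TRn\<close> have the product topology.\<close>

type_synonym tr = "int \<times> real"

definition TRn :: "(tr ^ 'n::finite) set" where
  "TRn = {p. \<forall>k. p $ k \<in> {1, - 1} \<times> UNIV}"

definition trop :: "puiseux \<Rightarrow> tr" where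
  "trop x = (if x > 0 then 1 else - 1, real_of_rat (pval x))"

definition trop_vec :: "puiseux ^ 'n::finite \<Rightarrow> tr ^ 'n" where
  "trop_vec x = (\<chi> k. trop (x $ k))"

definition absv :: "tr ^ 'n::finite \<Rightarrow> real ^ 'n" where
  "absv p = (\<chi> k. snd (p $ k))"

definition trop_set :: "(puiseux ^ 'n::finite) set \<Rightarrow> (tr ^ 'n) set" where
  "trop_set V = top_of_set TRn closure_of (trop_vec ` (V \<inter> {x. \<forall>k. x $ k \<noteq> 0}))"

text \<open>A real tropical polynomial is a partial map sending the exponents in its support to
  their coefficients.\<close>

type_synonym 'n trpoly = "('n \<Rightarrow>\<^sub>0 nat) \<rightharpoonup> tr"

definition trop_poly :: "'n::finite pmpoly \<Rightarrow> 'n trpoly" where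
  "trop_poly F = (\<lambda>l. if l \<in> Poly_Mapping.keys F then Some (trop (Poly_Mapping.lookup F l)) else None)"

definition exponent_vec :: "('n::finite \<Rightarrow>\<^sub>0 nat) \<Rightarrow> real ^ 'n" where
  "exponent_vec l = (\<chi> k. real (Poly_Mapping.lookup l k))"

definition term_val :: "'n::finite trpoly \<Rightarrow> real ^ 'n \<Rightarrow> ('n \<Rightarrow>\<^sub>0 nat) \<Rightarrow> real" where
  "term_val f w l = snd (the (f l)) + exponent_vec l \<bullet> w"

definition term_sign :: "'n::finite trpoly \<Rightarrow> tr ^ 'n \<Rightarrow> ('n \<Rightarrow>\<^sub>0 nat) \<Rightarrow> int" where
  "term_sign f p l = fst (the (f l)) * (\<Prod>k\<in>UNIV. fst (p $ k) ^ Poly_Mapping.lookup l k)"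

definition min_exponents :: "'n::finite trpoly \<Rightarrow> real ^ 'n \<Rightarrow> ('n \<Rightarrow>\<^sub>0 nat) set" where
  "min_exponents f w = {l \<in> dom f. \<forall>l'\<in>dom f. term_val f w l \<le> term_val f w l'}"

definition real_trop_hypersurface :: "'n::finite pmpoly \<Rightarrow> (tr ^ 'n) set" where
  "real_trop_hypersurface F =
    (let f = trop_poly F in
      {p \<in> TRn. \<exists>i\<in>min_exponents f (absv p). \<exists>j\<in>min_exponents f (absv p).
        i \<noteq> j \<and> term_sign f p i = 1 \<and> term_sign f p j = - 1})"

text \<open>A cell is the set of those points of some \<open>min_exponents f w\<close> that lie on a face of its convex hull.
  The whole set itself and the empty set are included.\<close>

definition dual_subdivision :: "'n::finite trpoly \<Rightarrow> ('n \<Rightarrow>\<^sub>0 nat) set set" where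
  "dual_subdivision f =
    {{l \<in> min_exponents f w. exponent_vec l \<in> T} | w T.
      T face_of (convex hull (exponent_vec ` min_exponents f w))}"

definition is_triangulation :: "('n::finite \<Rightarrow>\<^sub>0 nat) set set \<Rightarrow> bool" where
  "is_triangulation \<C> \<longleftrightarrow> (\<forall>C\<in>\<C>. \<not> affine_dependent (exponent_vec ` C))"

definition real_tropical_basis :: "'n::finite pmpoly set \<Rightarrow> 'n pmpoly set \<Rightarrow> bool" where
  "real_tropical_basis B I \<longleftrightarrow>
    finite B \<and> ideal_gen B = I \<and>
    trop_set (zero_locus I) = {p \<in> TRn. \<forall>F\<in>B. p \<in> real_trop_hypersurface F}"

end

theory Submission
  imports Defs
begin

text \<open>At a zero of \<open>F\<close> in the torus the leading coefficients of the terms of least valuation cancel, so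
  both signs occur among them; as the real tropical hypersurface is closed, this gives one inclusion.

  Conversely, let two terms \<open>i\<close>, \<open>j\<close> of opposite sign be minimal at \<open>p\<close>. The terms minimal at \<open>p\<close>
  form a cell, so their exponents are affinely independent and \<open>\<bar>p\<bar>\<close> can be perturbed to a
  rational point at which \<open>i\<close> and \<open>j\<close> are the only minimal terms. Substituting a point \<open>x\<close> of the
  torus that tropicalizes there and rescaling one coordinate, whose exponents in \<open>i\<close> and \<open>j\<close> differ,
  by an unknown unit \<open>y\<close> leaves a univariate equation. Its reduction is a binomial with
  coefficients of opposite sign, which has a simple positive root, and Hensel's lemma lifts this root
  without changing the sign or the valuation of the coordinate.\<close>

no_notation fps_nth (infixl "$" 75)

section \<open>Hensel's lemma for formal power series\<close>

lemma fps_X_power_dvd_iff: "fps_X ^ n dvd (f :: 'a::comm_ring_1 fps) \<longleftrightarrow> (\<forall>k<n. fps_nth f k = 0)"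
proof
  assume "fps_X ^ n dvd f"
  then show "\<forall>k<n. fps_nth f k = 0" by (auto simp: fps_X_power_mult_nth elim!: dvdE)
next
  assume "\<forall>k<n. fps_nth f k = 0"
  then have "f = fps_X ^ n * fps_shift n f"
    by (intro fps_ext) (auto simp: fps_X_power_mult_nth)
  then show "fps_X ^ n dvd f" by (rule dvdI)
qed

lemma poly_taylor_quadratic:
  fixes p :: "'a::idom poly"
  shows "\<exists>r. poly p (a + h) = poly p a + h * poly (pderiv p) a + h\<^sup>2 * r"
proof (induction p)
  case (pCons c p)
  then obtain r where r: "poly p (a + h) = poly p a + h * poly (pderiv p) a + h\<^sup>2 * r" by blast
  show ?case
    by (rule exI[of _ "poly (pderiv p) a + (a + h) * r"])
      (simp add: r pderiv_pCons algebra_simps power2_eq_square)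
qed simp

lemma diff_dvd_poly_diff: "(a - b :: 'a::idom) dvd poly p a - poly p b"
proof -
  obtain r where "poly p (b + (a - b)) = poly p b + (a - b) * poly (pderiv p) b + (a - b)\<^sup>2 * r"
    using poly_taylor_quadratic by blast
  then have "poly p a - poly p b = (a - b) * (poly (pderiv p) b + (a - b) * r)"
    by (simp add: algebra_simps power2_eq_square)
  then show ?thesis by simp
qed

lemma fps_hensel_step:
  fixes p :: "'a::field fps poly"
  assumes y: "fps_X ^ Suc n dvd poly p y" and simple: "fps_nth (poly (pderiv p) y) 0 \<noteq> 0"
  shows "\<exists>z. fps_X ^ Suc (Suc n) dvd poly p z \<and> fps_X ^ Suc n dvd z - y"
proof -
  define D where "D = poly (pderiv p) y"
  obtain u where u: "poly p y = fps_X ^ Suc n * u" using y by (elim dvdE)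
  define h where "h = fps_X ^ Suc n * fps_const (- (fps_nth u 0 / fps_nth D 0))"
  obtain r where r: "poly p (y + h) = poly p y + h * D + h\<^sup>2 * r"
    unfolding D_def using poly_taylor_quadratic by blast
  have "fps_nth (u + fps_const (- (fps_nth u 0 / fps_nth D 0)) * D) 0 = 0"
    using simple by (simp add: D_def)
  then have "fps_X ^ 1 dvd u + fps_const (- (fps_nth u 0 / fps_nth D 0)) * D"
    by (subst fps_X_power_dvd_iff) simp
  then have "fps_X ^ Suc n * fps_X dvd
      fps_X ^ Suc n * (u + fps_const (- (fps_nth u 0 / fps_nth D 0)) * D)"
    by (intro mult_dvd_mono) simp_all
  then have 1: "fps_X ^ Suc (Suc n) dvd poly p y + h * D"
    by (simp add: u h_def algebra_simps)
  have "fps_X ^ Suc (Suc n) dvd (fps_X ^ Suc n)\<^sup>2"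
    by (subst power_mult[symmetric], rule le_imp_power_dvd) simp
  then have 2: "fps_X ^ Suc (Suc n) dvd h\<^sup>2 * r"
    unfolding h_def power_mult_distrib mult.assoc by (rule dvd_mult2)
  have "fps_X ^ Suc (Suc n) dvd poly p (y + h)"
    unfolding r using 1 2 by (rule dvd_add)
  moreover have "fps_X ^ Suc n dvd (y + h) - y" by (simp add: h_def del: power_Suc)
  ultimately show ?thesis by blast
qed

lemma fps_hensel:
  fixes p :: "'a::field fps poly"
  assumes root: "fps_nth (poly p y0) 0 = 0"
    and simple: "fps_nth (poly (pderiv p) y0) 0 \<noteq> 0"
  obtains y where "poly p y = 0" "fps_nth y 0 = fps_nth y0 0"
proof -
  let ?P = "\<lambda>n y. fps_X ^ Suc n dvd poly p y \<and> fps_nth y 0 = fps_nth y0 0"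
  have cong: "fps_nth (poly q a) k = fps_nth (poly q b) k"
    if "fps_X ^ Suc n dvd a - b" "k < Suc n" for q :: "'a fps poly" and a b k n
  proof -
    have "fps_X ^ Suc n dvd poly q a - poly q b"
      using that(1) diff_dvd_poly_diff by (rule dvd_trans)
    then show ?thesis using that(2) by (simp add: fps_X_power_dvd_iff del: power_Suc)
  qed
  have "\<exists>f. \<forall>n. ?P n (f n) \<and> fps_X ^ Suc n dvd f (Suc n) - f n"
  proof (rule dependent_nat_choice)
    show "\<exists>y. ?P 0 y" using root fps_X_power_dvd_iff[of 1] by auto
  next
    fix y n assume y: "?P n y"
    have "fps_X ^ Suc 0 dvd y - y0" using y by (subst fps_X_power_dvd_iff) simp
    then have "fps_nth (poly (pderiv p) y) 0 \<noteq> 0" using simple cong[of 0 y y0 0] by simp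
    then obtain z where z: "fps_X ^ Suc (Suc n) dvd poly p z" "fps_X ^ Suc n dvd z - y"
      using fps_hensel_step y by blast
    then have "fps_nth (z - y) 0 = 0" by (simp add: fps_X_power_dvd_iff del: power_Suc)
    then show "\<exists>z. ?P (Suc n) z \<and> fps_X ^ Suc n dvd z - y" using y z by auto
  qed
  then obtain f where f: "\<And>n. ?P n (f n)" and step: "\<And>n. fps_X ^ Suc n dvd f (Suc n) - f n"
    by blast
  define y where "y = Abs_fps (\<lambda>n. fps_nth (f n) n)"
  have stable: "fps_nth (f (k + d)) k = fps_nth (f k) k" for k d
  proof (induction d)
    case (Suc d)
    have "fps_nth (f (Suc (k + d)) - f (k + d)) k = 0"
      using step[of "k + d"] by (simp add: fps_X_power_dvd_iff del: power_Suc)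
    then show ?case using Suc by simp
  qed simp
  have "fps_X ^ Suc n dvd y - f n" for n
    unfolding fps_X_power_dvd_iff
  proof (intro allI impI)
    fix k assume "k < Suc n"
    then show "fps_nth (y - f n) k = 0" using stable[of k "n - k"] by (simp add: y_def)
  qed
  then have "fps_nth (poly p y) n = 0" for n
    using cong[of n y "f n" n p] f[of n] by (simp add: fps_X_power_dvd_iff del: power_Suc)
  then have "poly p y = 0" by (intro fps_ext) simp
  moreover have "fps_nth y 0 = fps_nth y0 0" using f[of 0] by (simp add: y_def)
  ultimately show ?thesis using that by blast
qed

section \<open>Positive roots over the Puiseux series\<close>

lemma pval_le: "pcoeff x q \<noteq> 0 \<Longrightarrow> pval x \<le> q"
proof -
  assume q: "pcoeff x q \<noteq> 0"
  obtain m f where m: "m > 0" and x: "pcoeff x = ramify m f" by (rule puiseux_common1)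
  obtain k where k: "q = of_int k / of_nat m" "fls_nth f k \<noteq> 0"
    using ramify_nonzeroD[OF m] q unfolding x by metis
  then have "fls_subdegree f \<le> k" "f \<noteq> 0" by (auto simp: fls_subdegree_leI)
  then show ?thesis using m by (simp add: pval_ramify[OF m x] k divide_right_mono)
qed

lemma pval_eqI: "pcoeff x q \<noteq> 0 \<Longrightarrow> (\<And>r. r < q \<Longrightarrow> pcoeff x r = 0) \<Longrightarrow> pval x = q"
  unfolding pval_def by (rule Least_equality) (auto simp: not_less[symmetric])

lemma pval_mult:
  assumes "x \<noteq> 0" "y \<noteq> 0"
  shows "pval (x * y) = pval x + pval y"
proof -
  obtain m f g where m: "m > 0" and x: "pcoeff x = ramify m f" and y: "pcoeff y = ramify m g"
    by (rule puiseux_common2)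
  have nz: "f \<noteq> 0" "g \<noteq> 0"
    using assms pcoeff_ramify_eq_0_iff[OF m x] pcoeff_ramify_eq_0_iff[OF m y] by auto
  then show ?thesis
    by (simp add: pval_ramify[OF m x] pval_ramify[OF m y]
        pval_ramify[OF m pcoeff_ramify_mult[OF m x y]] add_divide_distrib)
qed

lemma pval_1: "pval 1 = 0"
  by (rule pval_eqI) (auto simp: one_puiseux.rep_eq)

lemma pval_power: "x \<noteq> 0 \<Longrightarrow> pval (x ^ n) = of_nat n * pval x"
  by (induction n) (simp_all add: pval_1 pval_mult algebra_simps)

lemma pval_prod:
  "finite A \<Longrightarrow> (\<And>k. k \<in> A \<Longrightarrow> x k \<noteq> 0) \<Longrightarrow> pval (\<Prod>k\<in>A. x k) = (\<Sum>k\<in>A. pval (x k))"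
  by (induction A rule: finite_induct) (simp_all add: pval_1 pval_mult)

lemma pcoeff_sum: "pcoeff (\<Sum>a\<in>A. x a) q = (\<Sum>a\<in>A. pcoeff (x a) q)"
  by (induction A rule: infinite_finite_induct)
    (simp_all add: zero_puiseux.rep_eq plus_puiseux.rep_eq)

lemma puiseux_common_finite:
  assumes "finite S"
  obtains m where "m > 0" "\<And>x. x \<in> S \<Longrightarrow> \<exists>f. pcoeff x = ramify m f"
proof -
  have "\<exists>m>0. \<forall>x\<in>S. \<exists>f. pcoeff x = ramify m f"
    using assms
  proof (induction S rule: finite_induct)
    case (insert y S)
    then obtain m where m: "m > 0" "\<And>x. x \<in> S \<Longrightarrow> \<exists>f. pcoeff x = ramify m f" by blast
    obtain n g where n: "n > 0" "pcoeff y = ramify n g" by (rule puiseux_common1)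
    have "\<exists>f. pcoeff x = ramify (m * n) f" if "x \<in> insert y S" for x
    proof (cases "x = y")
      case True
      then show ?thesis
        using n m(1) ramify_refine[of n m g] by (metis mult.commute)
    next
      case False
      with that m(2) obtain f where "pcoeff x = ramify m f" by blast
      then show ?thesis using n(1) m(1) ramify_refine[of m n f] by metis
    qed
    then show ?case using m(1) n(1) by (intro exI[of _ "m * n"]) simp
  qed auto
  then show ?thesis using that by blast
qed

definition puiseux_of_fps :: "nat \<Rightarrow> real fps \<Rightarrow> puiseux" where
  "puiseux_of_fps m f = Abs_puiseux (ramify m (fps_to_fls f))"

lemma pcoeff_puiseux_of_fps:
  "m > 0 \<Longrightarrow> pcoeff (puiseux_of_fps m f) = ramify m (fps_to_fls f)"
  unfolding puiseux_of_fps_def by (rule Abs_puiseux_inverse[OF ramify_in])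

lemma puiseux_of_fps_eqI:
  "m > 0 \<Longrightarrow> pcoeff x = ramify m (fps_to_fls f) \<Longrightarrow> puiseux_of_fps m f = x"
  by (metis pcoeff_inject pcoeff_puiseux_of_fps)

lemma puiseux_of_fps_0: "m > 0 \<Longrightarrow> puiseux_of_fps m 0 = 0"
  by (rule puiseux_of_fps_eqI) (simp_all add: zero_puiseux.rep_eq ramify_0)

lemma puiseux_of_fps_1: "m > 0 \<Longrightarrow> puiseux_of_fps m 1 = 1"
  by (rule puiseux_of_fps_eqI) (simp_all add: pcoeff_ramify_1)

lemma puiseux_of_fps_add:
  "m > 0 \<Longrightarrow> puiseux_of_fps m (f + g) = puiseux_of_fps m f + puiseux_of_fps m g"
  by (rule puiseux_of_fps_eqI)
    (simp_all add: pcoeff_ramify_add[OF pcoeff_puiseux_of_fps pcoeff_puiseux_of_fps])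

lemma puiseux_of_fps_mult:
  "m > 0 \<Longrightarrow> puiseux_of_fps m (f * g) = puiseux_of_fps m f * puiseux_of_fps m g"
  by (rule puiseux_of_fps_eqI)
    (simp_all add: pcoeff_ramify_mult[OF _ pcoeff_puiseux_of_fps pcoeff_puiseux_of_fps]
      fls_times_fps_to_fls)

lemma puiseux_of_fps_power: "m > 0 \<Longrightarrow> puiseux_of_fps m (f ^ n) = puiseux_of_fps m f ^ n"
  by (induction n) (simp_all add: puiseux_of_fps_1 puiseux_of_fps_mult)

lemma puiseux_of_fps_sum:
  "m > 0 \<Longrightarrow> puiseux_of_fps m (\<Sum>a\<in>A. f a) = (\<Sum>a\<in>A. puiseux_of_fps m (f a))"
  by (induction A rule: infinite_finite_induct)
    (simp_all add: puiseux_of_fps_0 puiseux_of_fps_add)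

lemma puiseux_of_fps_integral:
  assumes m: "m > 0" and x: "pcoeff x = ramify m f" and neg: "\<And>q. q < 0 \<Longrightarrow> pcoeff x q = 0"
  shows "\<exists>g. x = puiseux_of_fps m g"
proof -
  have "fls_nth f k = 0" if "k < 0" for k
  proof -
    have "of_int k / of_nat m < (0::rat)" using that m by (simp add: divide_neg_pos)
    from neg[OF this] show ?thesis by (simp add: x m)
  qed
  then have "f = fps_to_fls (fls_regpart f)" by (intro fls_eqI) simp
  then show ?thesis using puiseux_of_fps_eqI[OF m] x by metis
qed

lemma pcoeff_puiseux_of_fps_neg: "m > 0 \<Longrightarrow> q < 0 \<Longrightarrow> pcoeff (puiseux_of_fps m f) q = 0"
proof -
  assume m: "m > 0" and "q < 0"
  then have "\<lfloor>q * of_nat m\<rfloor> < 0" by (simp add: mult_neg_pos)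
  then show ?thesis using m by (simp add: pcoeff_puiseux_of_fps ramify_def)
qed

lemma pcoeff_puiseux_of_fps_at_0: "m > 0 \<Longrightarrow> pcoeff (puiseux_of_fps m f) 0 = fps_nth f 0"
  by (simp add: pcoeff_puiseux_of_fps ramify_def)

lemma binomial_positive_root:
  fixes c :: real
  assumes "c < 0" "a \<noteq> b"
  obtains y where "y > 0" "y ^ a + c * y ^ b = 0"
proof -
  define y where "y = (- c) powr (1 / (real a - real b))"
  have y: "y > 0" using assms by (simp add: y_def)
  have "y ^ a = y powr (real a - real b) * y powr real b"
    using y by (simp add: powr_add[symmetric] flip: powr_realpow)
  also have "y powr (real a - real b) = - c"
    using assms by (simp add: y_def powr_powr)
  finally have "y ^ a + c * y ^ b = 0" using y by (simp add: powr_realpow)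
  with y that show ?thesis by blast
qed

lemma puiseux_positive_unit_root:
  fixes T :: "'a \<Rightarrow> puiseux" and d :: "'a \<Rightarrow> nat"
  assumes A: "finite A" and nz: "\<And>l. l \<in> A \<Longrightarrow> T l \<noteq> 0"
    and ij: "i \<in> A" "j \<in> A" "d i \<noteq> d j"
    and val: "pval (T i) = pval (T j)" "\<And>l. l \<in> A - {i, j} \<Longrightarrow> pval (T i) < pval (T l)"
    and opp: "pleading (T i) * pleading (T j) < 0"
  obtains y where "y > 0" "pval y = 0" "(\<Sum>l\<in>A. T l * y ^ d l) = 0"
proof -
  define u where "u = (\<lambda>l. T l / T i)"
  have T: "T l = u l * T i" for l using nz ij by (simp add: u_def)
  have u_nz: "u l \<noteq> 0" if "l \<in> A" for l using nz ij that by (simp add: u_def)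
  have u_val: "pval (T l) = pval (u l) + pval (T i)" if "l \<in> A" for l
    using T[of l] pval_mult[OF u_nz[OF that] nz[OF ij(1)]] by simp
  have ij_ne: "i \<noteq> j" using ij by blast
  have u_neg: "pcoeff (u l) q = 0" if "l \<in> A" "q < 0" for l q
  proof (rule ccontr)
    assume "pcoeff (u l) q \<noteq> 0"
    then have "pval (u l) \<le> q" by (rule pval_le)
    moreover have "pval (T i) \<le> pval (T l)"
      using that val by (cases "l \<in> {i, j}") (auto intro: less_imp_le)
    ultimately show False using u_val[OF that(1)] that(2) by simp
  qed
  have u_0: "pcoeff (u l) 0 = 0" if "l \<in> A - {i, j}" for l
  proof (rule ccontr)
    assume "pcoeff (u l) 0 \<noteq> 0"
    then have "pval (u l) \<le> 0" by (rule pval_le)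
    then show False using u_val[of l] val(2)[OF that] that by simp
  qed
  define c where "c = pcoeff (u j) 0"
  have "pval (u j) = 0" using u_val[OF ij(2)] val by simp
  then have "pleading (T j) = c * pleading (T i)"
    using T[of j] pleading_mult[of "u j" "T i"] by (simp add: c_def pleading_def[of "u j"])
  then have "c * (pleading (T i))\<^sup>2 < 0" using opp by (simp add: power2_eq_square algebra_simps)
  then have c: "c < 0" by (simp add: mult_less_0_iff)
  have u_i: "pcoeff (u i) 0 = 1" using nz ij by (simp add: u_def one_puiseux.rep_eq)
  obtain m where m: "m > 0" and "\<And>x. x \<in> u ` A \<Longrightarrow> \<exists>f. pcoeff x = ramify m f"
    using A by (rule puiseux_common_finite[OF finite_imageI]) blast
  then have "\<forall>l\<in>A. \<exists>g. u l = puiseux_of_fps m g"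
    using u_neg puiseux_of_fps_integral[OF m] by blast
  then obtain b where b: "\<And>l. l \<in> A \<Longrightarrow> u l = puiseux_of_fps m (b l)" by metis
  have b0: "fps_nth (b l) 0 = pcoeff (u l) 0" if "l \<in> A" for l
    using b[OF that] m by (simp add: pcoeff_puiseux_of_fps_at_0)
  have sum_ij: "(\<Sum>l\<in>A. fps_nth (b l) 0 * h l) = h i + c * h j" for h :: "'a \<Rightarrow> real"
  proof -
    have "(\<Sum>l\<in>A. fps_nth (b l) 0 * h l) = (\<Sum>l\<in>{i, j}. fps_nth (b l) 0 * h l)"
      using A ij b0 u_0 by (intro sum.mono_neutral_right) auto
    then show ?thesis using ij ij_ne u_i by (simp add: b0 c_def)
  qed
  obtain y0 where y0: "y0 > 0" "y0 ^ d i + c * y0 ^ d j = 0"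
    using binomial_positive_root[OF c ij(3)] by blast
  define p where "p = (\<Sum>l\<in>A. monom (b l) (d l))"
  have poly_p: "poly p y = (\<Sum>l\<in>A. b l * y ^ d l)" for y
    by (simp add: p_def poly_sum poly_monom)
  have const_pow: "fps_nth (fps_const y0 ^ n) 0 = y0 ^ n" for n
    by (simp add: fps_const_power)
  have "fps_nth (poly p (fps_const y0)) 0 = (\<Sum>l\<in>A. fps_nth (b l) 0 * y0 ^ d l)"
    by (simp add: poly_p fps_sum_nth const_pow)
  then have root: "fps_nth (poly p (fps_const y0)) 0 = 0" using y0(2) by (simp add: sum_ij)
  have "poly (pderiv p) y = (\<Sum>l\<in>A. of_nat (d l) * b l * y ^ (d l - 1))" for y
    using higher_pderiv_sum[of 1 "\<lambda>l. monom (b l) (d l)" A]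
    by (simp add: p_def poly_sum poly_monom pderiv_monom)
  then have "fps_nth (poly (pderiv p) (fps_const y0)) 0 =
      (\<Sum>l\<in>A. fps_nth (b l) 0 * (real (d l) * y0 ^ (d l - 1)))"
    by (simp add: fps_sum_nth const_pow mult_ac)
  also have "\<dots> = real (d i) * y0 ^ (d i - 1) + c * (real (d j) * y0 ^ (d j - 1))"
    by (rule sum_ij)
  finally have deriv: "fps_nth (poly (pderiv p) (fps_const y0)) 0 * y0 =
      real (d i) * (y0 ^ (d i - 1) * y0) + c * (real (d j) * (y0 ^ (d j - 1) * y0))"
    by (simp add: algebra_simps)
  have pow: "real n * (y0 ^ (n - 1) * y0) = real n * y0 ^ n" for n
    by (cases n) simp_all
  have "c * (real (d j) * y0 ^ d j) = - real (d j) * y0 ^ d i"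
  proof -
    have "real (d j) * (y0 ^ d i + c * y0 ^ d j) = 0" using y0(2) by simp
    then show ?thesis by (simp add: algebra_simps)
  qed
  then have "fps_nth (poly (pderiv p) (fps_const y0)) 0 * y0 = (real (d i) - real (d j)) * y0 ^ d i"
    unfolding deriv pow by (simp add: algebra_simps)
  then have simple: "fps_nth (poly (pderiv p) (fps_const y0)) 0 \<noteq> 0"
    using y0(1) ij(3) by auto
  obtain y where y: "poly p y = 0" "fps_nth y 0 = y0"
    using fps_hensel[OF root simple] by auto
  define z where "z = puiseux_of_fps m y"
  have z0: "pcoeff z 0 = y0" using m y by (simp add: z_def pcoeff_puiseux_of_fps_at_0)
  then have "pval z = 0"
    using y0 m by (intro pval_eqI) (auto simp: z_def pcoeff_puiseux_of_fps_neg)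
  moreover from this have "z > 0" using z0 y0 by (simp add: puiseux_pos_iff pleading_def)
  moreover have "(\<Sum>l\<in>A. T l * z ^ d l) = puiseux_of_fps m (poly p y) * T i"
  proof -
    have "T l * z ^ d l = puiseux_of_fps m (b l * y ^ d l) * T i" if "l \<in> A" for l
      using m T[of l] b[OF that]
      by (simp add: puiseux_of_fps_mult puiseux_of_fps_power z_def)
    then show ?thesis using m by (simp add: poly_p puiseux_of_fps_sum sum_distrib_right)
  qed
  then have "(\<Sum>l\<in>A. T l * z ^ d l) = 0" using m y by (simp add: puiseux_of_fps_0)
  ultimately show ?thesis using that by blast
qed

section \<open>Rational points near a minimal edge\<close>

lemma rational_point_in_open:
  fixes V :: "(real ^ 'n) set"
  assumes "open V" "V \<noteq> {}"
  obtains u where "u \<in> V" "\<And>k. u $ k \<in> \<rat>"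
proof -
  let ?Q = "\<Union>f\<in>Basis \<rightarrow> \<rat>. {\<Sum>b\<in>Basis. f b *\<^sub>R b} :: (real ^ 'n) set"
  have "V \<inter> ?Q \<noteq> {}"
    using assms open_Int_closure_eq_empty[of V ?Q] closure_rational_coordinates by auto
  then obtain f where f: "f \<in> Basis \<rightarrow> \<rat>" "(\<Sum>b\<in>Basis. f b *\<^sub>R b) \<in> V" by blast
  have "(\<Sum>b\<in>Basis. f b *\<^sub>R b) $ k = f (axis k 1)" for k
  proof -
    have "(\<Sum>b\<in>Basis. f b *\<^sub>R b) \<bullet> axis k 1 = f (axis k 1)"
      by (rule inner_sum_left_Basis) (simp add: axis_in_Basis_iff)
    then show ?thesis by (simp add: inner_axis)
  qed
  moreover have "axis k 1 \<in> (Basis :: (real ^ 'n) set)" for k by (simp add: axis_in_Basis_iff)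
  ultimately show ?thesis using f(1) by (intro that[OF f(2)]) (auto dest: Pi_mem)
qed

lemma affine_independent_dual_direction:
  fixes e :: "'a \<Rightarrow> real ^ 'n"
  assumes indep: "\<not> affine_dependent (e ` M)" and inj: "inj_on e M" and i: "i \<in> M"
  obtains d where "\<And>l. l \<in> M - {i} \<Longrightarrow> (e l - e i) \<bullet> d = (h l :: real)"
proof -
  let ?f = "\<lambda>l. - e i + e l"
  have "e ` M = insert (e i) (e ` (M - {i}))" using i by auto
  moreover have "e i \<notin> e ` (M - {i})" using inj i by (auto simp: inj_on_def)
  ultimately have "independent ((\<lambda>x. - e i + x) ` e ` (M - {i}))"
    using indep affine_dependent_iff_dependent by metis
  then have "independent (?f ` (M - {i}))" unfolding image_image .
  from linear_independent_extend[OF this, of "\<lambda>x. h (the_inv_into (M - {i}) ?f x)"]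
  obtain g where g: "linear g"
    "\<And>l. l \<in> M - {i} \<Longrightarrow> g (?f l) = h (the_inv_into (M - {i}) ?f (?f l))"
    by (auto simp only: ball_simps)
  have inj_f: "inj_on ?f (M - {i})" using inj by (auto simp: inj_on_def)
  show ?thesis
  proof (rule that)
    fix l assume "l \<in> M - {i}"
    then have "g (?f l) = h l" by (simp only: g(2) the_inv_into_f_f[OF inj_f])
    then show "(e l - e i) \<bullet> adjoint g 1 = h l" by (simp add: adjoint_works[OF g(1)])
  qed
qed

text \<open>Affine independence lets one leave \<open>w\<close> along a direction in which only \<open>i\<close> and \<open>j\<close> stay
  minimal; the resulting strict inequalities survive moving to a rational point of the rational
  hyperplane on which \<open>i\<close> and \<open>j\<close> tie.\<close>

lemma rational_point_near_minimal_edge: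
  fixes e :: "'a \<Rightarrow> real ^ 'n" and c :: "'a \<Rightarrow> real"
  assumes A: "finite A" and rat: "\<And>l. l \<in> {i, j} \<Longrightarrow> c l \<in> \<rat>" "\<And>l k. l \<in> {i, j} \<Longrightarrow> e l $ k \<in> \<rat>"
    and M: "M = {l \<in> A. \<forall>l'\<in>A. c l + e l \<bullet> w \<le> c l' + e l' \<bullet> w}"
    and indep: "\<not> affine_dependent (e ` M)" and inj: "inj_on e M"
    and ij: "i \<in> M" "j \<in> M" "i \<noteq> j"
    and V: "open V" "w \<in> V"
  obtains u where "u \<in> V" "\<And>k. u $ k \<in> \<rat>" "c i + e i \<bullet> u = c j + e j \<bullet> u"
    "\<And>l. l \<in> A - {i, j} \<Longrightarrow> c i + e i \<bullet> u < c l + e l \<bullet> u"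
proof -
  define gap where "gap l u = c l + e l \<bullet> u - (c i + e i \<bullet> u)" for l u
  have gap_cont: "continuous_on UNIV (gap l)" for l
    unfolding gap_def by (intro continuous_intros)
  have gap_M: "gap l w = 0" if "l \<in> M" for l
    using that ij unfolding M gap_def by (auto intro!: antisym)
  have gap_A: "gap l w > 0" if "l \<in> A - M" for l
  proof -
    from that obtain l' where "l' \<in> A" "c l' + e l' \<bullet> w < c l + e l \<bullet> w"
      unfolding M by (auto simp: not_le)
    moreover have "c i + e i \<bullet> w \<le> c l' + e l' \<bullet> w" using ij(1) \<open>l' \<in> A\<close> unfolding M by blast
    ultimately show ?thesis by (simp add: gap_def)
  qed
  have gap_open: "open {u. \<forall>l\<in>B. gap l u > 0}" if "B \<subseteq> A" for B
  proof -
    have "{u. \<forall>l\<in>B. gap l u > 0} = (\<Inter>l\<in>B. {u. 0 < gap l u})" by auto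
    then show ?thesis
      using finite_subset[OF that A] gap_cont
      by (auto intro!: open_INT open_Collect_less continuous_intros)
  qed
  obtain d where d: "\<And>l. l \<in> M - {i} \<Longrightarrow> (e l - e i) \<bullet> d = (if l = j then 0 else 1)"
    using affine_independent_dual_direction[OF indep inj ij(1), where h = "\<lambda>l. if l = j then 0 else 1"]
    by blast
  have "open ((\<lambda>\<epsilon>. w + \<epsilon> *\<^sub>R d) -` ({u. \<forall>l\<in>A - M. gap l u > 0} \<inter> V))"
    using V gap_open by (intro open_vimage continuous_intros) auto
  moreover have "0 \<in> (\<lambda>\<epsilon>. w + \<epsilon> *\<^sub>R d) -` ({u. \<forall>l\<in>A - M. gap l u > 0} \<inter> V)"
    using V gap_A by simp
  ultimately obtain r where r: "r > 0"
    "\<And>\<epsilon>. dist \<epsilon> 0 < r \<Longrightarrow> w + \<epsilon> *\<^sub>R d \<in> {u. \<forall>l\<in>A - M. gap l u > 0} \<inter> V"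
    unfolding open_dist by (metis (no_types, lifting) vimageE)
  define u0 where "u0 = w + (r / 2) *\<^sub>R d"
  have u0: "u0 \<in> {u. \<forall>l\<in>A - M. gap l u > 0} \<inter> V"
    unfolding u0_def using r(1) by (intro r(2)) simp
  have gap_u0: "gap l u0 = gap l w + r / 2 * ((e l - e i) \<bullet> d)" for l
    by (simp add: gap_def u0_def inner_add_right inner_diff_left algebra_simps)
  define U where "U = {u. \<forall>l\<in>A - {i, j}. gap l u > 0} \<inter> V"
  have "gap l u0 > 0" if "l \<in> A - {i, j}" for l
  proof (cases "l \<in> M")
    case True
    then show ?thesis using that r(1) by (simp add: gap_u0 gap_M d)
  next
    case False
    then show ?thesis using u0 that by blast
  qed
  then have u0_U: "u0 \<in> U" using u0 by (simp add: U_def)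
  have gap_j: "gap j u0 = 0" using ij by (simp add: gap_u0 gap_M d)
  have U: "open U" unfolding U_def using V gap_open by auto
  define a where "a = e j - e i"
  have "e i \<noteq> e j" using inj ij by (auto simp: inj_on_def)
  then obtain k0 where k0: "a $ k0 \<noteq> 0" by (metis a_def eq_iff_diff_eq_0 vec_eq_iff vector_minus_component)
  define \<pi> where "\<pi> u = (\<chi> k. if k = k0 then (c i - c j - (\<Sum>k\<in>- {k0}. a $ k * u $ k)) / a $ k0 else u $ k)"
    for u :: "real ^ 'n"
  have gap_a: "gap j u = c j - c i + a $ k0 * u $ k0 + (\<Sum>k\<in>- {k0}. a $ k * u $ k)" for u
  proof -
    have "a \<bullet> u = a $ k0 * u $ k0 + (\<Sum>k\<in>- {k0}. a $ k * u $ k)"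
      using sum.remove[of UNIV k0 "\<lambda>k. a $ k * u $ k"] by (simp add: inner_vec_def Compl_eq_Diff_UNIV)
    then show ?thesis by (simp add: gap_def a_def inner_diff_left)
  qed
  have \<pi>_gap: "gap j (\<pi> u) = 0" for u
  proof -
    have "(\<Sum>k\<in>- {k0}. a $ k * \<pi> u $ k) = (\<Sum>k\<in>- {k0}. a $ k * u $ k)"
      by (intro sum.cong) (auto simp: \<pi>_def)
    then show ?thesis using k0 by (simp add: gap_a) (simp add: \<pi>_def)
  qed
  have "\<pi> u0 = u0"
    using gap_j k0 by (auto simp: \<pi>_def vec_eq_iff gap_a field_simps)
  moreover have "continuous_on UNIV \<pi>"
    unfolding \<pi>_def
  proof (rule continuous_on_vec_lambda)
    fix k show "continuous_on UNIV
      (\<lambda>u :: real ^ 'n. if k = k0 then (c i - c j - (\<Sum>k\<in>- {k0}. a $ k * u $ k)) / a $ k0 else u $ k)"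
      by (cases "k = k0") (use k0 in \<open>auto intro!: continuous_intros\<close>)
  qed
  ultimately have "open (\<pi> -` U)" "\<pi> -` U \<noteq> {}"
    using U u0_U by (auto intro!: open_vimage)
  then obtain s where s: "s \<in> \<pi> -` U" "\<And>k. s $ k \<in> \<rat>" using rational_point_in_open by blast
  have a_rat: "a $ k \<in> \<rat>" for k by (simp add: a_def rat)
  show ?thesis
  proof (rule that)
    show "\<pi> s \<in> V" using s by (simp add: U_def)
    show "\<pi> s $ k \<in> \<rat>" for k
      using rat a_rat s(2) by (auto simp: \<pi>_def intro!: Rats_divide Rats_diff Rats_sum Rats_mult)
    show "c i + e i \<bullet> \<pi> s = c j + e j \<bullet> \<pi> s" using \<pi>_gap[of s] by (simp add: gap_def)
    show "c i + e i \<bullet> \<pi> s < c l + e l \<bullet> \<pi> s" if "l \<in> A - {i, j}" for l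
      using s(1) that by (simp add: U_def gap_def)
  qed
qed

section \<open>Signs and valuations of the terms of a polynomial\<close>

lemma snd_trop: "snd (trop x) = real_of_rat (pval x)"
  by (simp add: trop_def)

lemma fst_trop: "fst (trop x) \<in> {1, - 1}"
  by (simp add: trop_def)

lemma fst_trop_mult:
  assumes "x \<noteq> 0" "y \<noteq> 0"
  shows "fst (trop (x * y)) = fst (trop x) * fst (trop y)"
  using assms pleading_eq_0_iff[of x] pleading_eq_0_iff[of y]
  by (auto simp: trop_def puiseux_pos_iff pleading_mult zero_less_mult_iff)

lemma fst_trop_1: "fst (trop 1) = 1"
  by (simp add: trop_def)

lemma fst_trop_power: "x \<noteq> 0 \<Longrightarrow> fst (trop (x ^ n)) = fst (trop x) ^ n"
  by (induction n) (simp_all add: fst_trop_1 fst_trop_mult)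

lemma fst_trop_prod:
  "finite A \<Longrightarrow> (\<And>k. k \<in> A \<Longrightarrow> x k \<noteq> 0) \<Longrightarrow> fst (trop (\<Prod>k\<in>A. x k)) = (\<Prod>k\<in>A. fst (trop (x k)))"
  by (induction A rule: finite_induct) (simp_all add: fst_trop_1 fst_trop_mult)

definition mpoly_term :: "'n::finite pmpoly \<Rightarrow> puiseux ^ 'n \<Rightarrow> ('n \<Rightarrow>\<^sub>0 nat) \<Rightarrow> puiseux" where
  "mpoly_term F x l = Poly_Mapping.lookup F l * (\<Prod>k\<in>UNIV. (x $ k) ^ Poly_Mapping.lookup l k)"

lemma mpoly_eval_eq_sum_terms: "mpoly_eval F x = (\<Sum>l\<in>Poly_Mapping.keys F. mpoly_term F x l)"
  by (simp add: mpoly_eval_def mpoly_term_def)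

lemma dom_trop_poly: "dom (trop_poly F) = Poly_Mapping.keys F"
  by (auto simp: trop_poly_def dom_def)

lemma
  assumes l: "l \<in> Poly_Mapping.keys F" and x: "\<And>k. x $ k \<noteq> 0"
  shows mpoly_term_nonzero: "mpoly_term F x l \<noteq> 0"
    and term_val_trop_vec:
      "term_val (trop_poly F) (absv (trop_vec x)) l = real_of_rat (pval (mpoly_term F x l))"
    and term_sign_trop_vec:
      "term_sign (trop_poly F) (trop_vec x) l = fst (trop (mpoly_term F x l))"
proof -
  let ?a = "Poly_Mapping.lookup F l" and ?m = "\<Prod>k\<in>UNIV. (x $ k) ^ Poly_Mapping.lookup l k"
  have nz: "?a \<noteq> 0" "?m \<noteq> 0" using l x by (simp_all add: in_keys_iff)
  then show "mpoly_term F x l \<noteq> 0" by (simp add: mpoly_term_def)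
  have "pval ?m = (\<Sum>k\<in>UNIV. of_nat (Poly_Mapping.lookup l k) * pval (x $ k))"
    using x by (simp add: pval_prod pval_power)
  then show "term_val (trop_poly F) (absv (trop_vec x)) l = real_of_rat (pval (mpoly_term F x l))"
    using l nz
    by (simp add: term_val_def trop_poly_def mpoly_term_def pval_mult snd_trop of_rat_add of_rat_sum
        of_rat_mult absv_def trop_vec_def exponent_vec_def inner_vec_def)
  have "fst (trop ?m) = (\<Prod>k\<in>UNIV. fst (trop (x $ k)) ^ Poly_Mapping.lookup l k)"
    using x by (simp add: fst_trop_prod fst_trop_power)
  then show "term_sign (trop_poly F) (trop_vec x) l = fst (trop (mpoly_term F x l))"
    using l nz by (simp add: term_sign_def trop_poly_def mpoly_term_def fst_trop_mult trop_vec_def)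
qed

lemma vanishing_sum_opposite_signs:
  fixes T :: "'a \<Rightarrow> puiseux"
  assumes A: "finite A" "A \<noteq> {}" and nz: "\<And>l. l \<in> A \<Longrightarrow> T l \<noteq> 0" and sum: "(\<Sum>l\<in>A. T l) = 0"
  obtains i j where "i \<in> A" "j \<in> A" "T i > 0" "T j < 0"
    "\<And>l. l \<in> A \<Longrightarrow> pval (T i) \<le> pval (T l)" "\<And>l. l \<in> A \<Longrightarrow> pval (T j) \<le> pval (T l)"
proof -
  define \<mu> where "\<mu> = Min ((\<lambda>l. pval (T l)) ` A)"
  have \<mu>: "\<mu> \<le> pval (T l)" if "l \<in> A" for l using A that by (simp add: \<mu>_def)
  have "\<mu> \<in> (\<lambda>l. pval (T l)) ` A" using A unfolding \<mu>_def by (intro Min_in) auto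
  then obtain l0 where l0: "l0 \<in> A" "pval (T l0) = \<mu>" by blast
  define h where "h l = pcoeff (T l) \<mu>" for l
  have h_pval: "pval (T l) = \<mu>" if "l \<in> A" "h l \<noteq> 0" for l
    using that pval_le[of "T l" \<mu>] \<mu>[of l] by (simp add: h_def)
  have h_pleading: "pleading (T l) = h l" if "pval (T l) = \<mu>" for l
    using that by (simp add: pleading_def h_def)
  have h_sum: "(\<Sum>l\<in>A. h l) = 0"
    using arg_cong[OF sum, of "\<lambda>x. pcoeff x \<mu>"]
    by (simp add: pcoeff_sum zero_puiseux.rep_eq h_def)
  have h_l0: "h l0 \<noteq> 0" using l0 nz pleading_eq_0_iff h_pleading by metis
  have "\<exists>i\<in>A. h i > 0"
  proof (rule ccontr)
    assume "\<not> ?thesis"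
    then have "(\<Sum>l\<in>A. - h l) = 0 \<longleftrightarrow> (\<forall>l\<in>A. - h l = 0)"
      using A by (intro sum_nonneg_eq_0_iff) (auto simp: not_less)
    then show False using h_sum h_l0 l0 by (simp add: sum_negf)
  qed
  moreover have "\<exists>j\<in>A. h j < 0"
  proof (rule ccontr)
    assume "\<not> ?thesis"
    then have "(\<Sum>l\<in>A. h l) = 0 \<longleftrightarrow> (\<forall>l\<in>A. h l = 0)"
      using A by (intro sum_nonneg_eq_0_iff) (auto simp: not_less)
    then show False using h_sum h_l0 l0 by simp
  qed
  ultimately obtain i j where ij: "i \<in> A" "h i > 0" "j \<in> A" "h j < 0" by blast
  then have "pval (T i) = \<mu>" "pval (T j) = \<mu>" using h_pval by force+
  then show ?thesis
    using ij \<mu> h_pleading[of i] h_pleading[of j] pleading_uminus[of "T j"]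
    by (intro that[of i j]) (auto simp: puiseux_pos_iff less_puiseux_def)
qed

lemma trop_vec_in_hypersurface:
  fixes F :: "'n::finite pmpoly"
  assumes F: "F \<noteq> 0" and x: "\<And>k. x $ k \<noteq> 0" and root: "mpoly_eval F x = 0"
  shows "trop_vec x \<in> real_trop_hypersurface F"
proof -
  let ?A = "Poly_Mapping.keys F" and ?f = "trop_poly F" and ?p = "trop_vec x"
  obtain i j where ij: "i \<in> ?A" "j \<in> ?A" "mpoly_term F x i > 0" "mpoly_term F x j < 0"
    "\<And>l. l \<in> ?A \<Longrightarrow> pval (mpoly_term F x i) \<le> pval (mpoly_term F x l)"
    "\<And>l. l \<in> ?A \<Longrightarrow> pval (mpoly_term F x j) \<le> pval (mpoly_term F x l)"
    using vanishing_sum_opposite_signs[of ?A "mpoly_term F x"] F x root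
    by (auto simp: mpoly_eval_eq_sum_terms mpoly_term_nonzero)
  have "i \<in> min_exponents ?f (absv ?p)" "j \<in> min_exponents ?f (absv ?p)"
    using ij x by (auto simp: min_exponents_def dom_trop_poly term_val_trop_vec of_rat_less_eq)
  moreover have "term_sign ?f ?p i = 1" "term_sign ?f ?p j = - 1"
    using ij x by (auto simp: term_sign_trop_vec trop_def)
  moreover from this have "i \<noteq> j" by auto
  moreover have "?p \<in> TRn" using fst_trop by (auto simp: TRn_def trop_vec_def mem_Times_iff)
  ultimately show ?thesis by (auto simp: real_trop_hypersurface_def Let_def)
qed

lemma closedin_hypersurface:
  fixes F :: "'n::finite pmpoly"
  shows "closedin (top_of_set TRn) (real_trop_hypersurface F)"
proof -
  let ?A = "Poly_Mapping.keys F" and ?f = "trop_poly F"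
  define S where "S i j = {p. (\<forall>l\<in>?A. term_val ?f (absv p) i \<le> term_val ?f (absv p) l)
      \<and> (\<forall>l\<in>?A. term_val ?f (absv p) j \<le> term_val ?f (absv p) l)
      \<and> term_sign ?f p i = 1 \<and> term_sign ?f p j = - 1}" for i j
  have val: "continuous_on UNIV (\<lambda>p. term_val ?f (absv p) l)" for l
    unfolding term_val_def absv_def
    by (intro continuous_intros continuous_on_vec_lambda)
  have sgn: "continuous_on UNIV (\<lambda>p. term_sign ?f p l)" for l
  proof -
    have pow: "continuous_on UNIV (\<lambda>p :: tr ^ 'n. fst (p $ k) ^ n)" for k n
      by (induction n) (auto intro!: continuous_intros)
    show ?thesis unfolding term_sign_def by (intro continuous_intros continuous_on_prod' pow)
  qed
  have "closed (S i j)" for i j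
    unfolding S_def Ball_def
    by (intro closed_Collect_conj closed_Collect_all closed_Collect_imp open_Collect_const closed_Collect_le closed_Collect_eq val sgn
        continuous_on_const)
  then have "closed (\<Union>i\<in>?A. \<Union>j\<in>?A. S i j)"
    by (intro closed_UN finite_keys ballI)
  moreover have "i \<noteq> j" if "term_sign ?f p i = 1" "term_sign ?f p j = - 1" for p i j
    using that by auto
  then have "real_trop_hypersurface F = TRn \<inter> (\<Union>i\<in>?A. \<Union>j\<in>?A. S i j)"
    unfolding real_trop_hypersurface_def Let_def min_exponents_def dom_trop_poly S_def by blast
  ultimately show ?thesis by (auto simp: closedin_closed)
qed

lemma exists_trop_eq:
  assumes "s \<in> {1, - 1}"
  obtains x where "x \<noteq> 0" "trop x = (s, real_of_rat q)"
proof -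
  obtain a m where q: "quotient_of q = (a, m)" by (cases "quotient_of q")
  have m: "m > 0" using q by (rule quotient_of_denom_pos)
  define x where "x = Abs_puiseux (ramify (nat m) (fls_X_intpow a))"
  have nm: "nat m > 0" using m by simp
  have x: "pcoeff x = ramify (nat m) (fls_X_intpow a)"
    unfolding x_def by (rule Abs_puiseux_inverse[OF ramify_in[OF nm]])
  have "pval x = q"
    using m quotient_of_div[OF q] by (simp add: pval_ramify[OF nm x])
  moreover have "pleading x = 1" by (simp add: pleading_ramify[OF nm x])
  ultimately have x: "x > 0" "pval x = q" "pval (- x) = q"
    by (simp_all add: puiseux_pos_iff pval_def uminus_puiseux.rep_eq)
  show ?thesis
    using assms x that[of x] that[of "- x"] by (auto simp: trop_def)
qed

section \<open>Zeros tropicalizing near the hypersurface\<close>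

lemma min_exponents_affine_independent:
  assumes "is_triangulation (dual_subdivision f)"
  shows "\<not> affine_dependent (exponent_vec ` min_exponents f w)"
proof -
  let ?M = "min_exponents f w"
  let ?H = "convex hull (exponent_vec ` ?M)"
  have "?H face_of ?H" by (rule face_of_refl) (rule convex_convex_hull)
  moreover have "{l \<in> ?M. exponent_vec l \<in> ?H} = ?M"
    by (auto intro!: hull_inc)
  ultimately have "?M \<in> dual_subdivision f" unfolding dual_subdivision_def by blast
  then show ?thesis using assms by (simp add: is_triangulation_def)
qed

lemma inj_exponent_vec: "inj exponent_vec"
  by (rule injI) (simp add: exponent_vec_def vec_eq_iff poly_mapping_eqI)

lemma exists_zero_near_hypersurface_point:
  fixes F :: "'n::finite pmpoly"
  assumes tri: "is_triangulation (dual_subdivision (trop_poly F))"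
    and p: "p \<in> real_trop_hypersurface F" and V: "open V" "p \<in> V"
  obtains x where "mpoly_eval F x = 0" "\<And>k. x $ k \<noteq> 0" "trop_vec x \<in> V"
proof -
  let ?A = "Poly_Mapping.keys F" and ?f = "trop_poly F"
  obtain i j where ij: "i \<in> min_exponents ?f (absv p)" "j \<in> min_exponents ?f (absv p)" "i \<noteq> j"
    and signs: "term_sign ?f p i = 1" "term_sign ?f p j = - 1"
    using p by (auto simp: real_trop_hypersurface_def Let_def)
  have ij_A: "i \<in> ?A" "j \<in> ?A" using ij by (auto simp: min_exponents_def dom_trop_poly)
  have p_sign: "fst (p $ k) \<in> {1, - 1}" for k
    using p by (auto simp: real_trop_hypersurface_def Let_def TRn_def mem_Times_iff)
  define lift :: "real ^ 'n \<Rightarrow> tr ^ 'n" where "lift u = (\<chi> k. (fst (p $ k), u $ k))" for u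
  have "continuous_on UNIV lift"
    unfolding lift_def by (intro continuous_on_vec_lambda continuous_intros)
  then have open_lift: "open (lift -` V)" using V(1) by (rule open_vimage[rotated])
  have "lift (absv p) = p" by (simp add: lift_def absv_def vec_eq_iff)
  then have p_lift: "absv p \<in> lift -` V" using V(2) by simp
  let ?c = "\<lambda>l. snd (the (?f l))"
  have c_rat: "?c l \<in> \<rat>" if "l \<in> {i, j}" for l
    using that ij_A by (auto simp: trop_poly_def snd_trop)
  have e_rat: "exponent_vec l $ k \<in> \<rat>" for l :: "'n \<Rightarrow>\<^sub>0 nat" and k
    by (simp add: exponent_vec_def)
  have min_eq: "min_exponents ?f (absv p) = {l \<in> ?A. \<forall>l'\<in>?A.
      ?c l + exponent_vec l \<bullet> absv p \<le> ?c l' + exponent_vec l' \<bullet> absv p}"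
    by (simp only: min_exponents_def dom_trop_poly term_val_def)
  obtain u where u: "u \<in> lift -` V" "\<And>k. u $ k \<in> \<rat>"
    "term_val ?f u i = term_val ?f u j"
    "\<And>l. l \<in> ?A - {i, j} \<Longrightarrow> term_val ?f u i < term_val ?f u l"
    using rational_point_near_minimal_edge[OF finite_keys c_rat e_rat min_eq
        min_exponents_affine_independent[OF tri] inj_on_subset[OF inj_exponent_vec subset_UNIV]
        ij open_lift p_lift]
    unfolding term_val_def by blast
  have "\<exists>z. z \<noteq> 0 \<and> trop z = (fst (p $ k), u $ k)" for k
    using u(2)[of k] exists_trop_eq[OF p_sign] by (metis Rats_cases)
  then obtain z where z: "\<And>k. z k \<noteq> 0" "\<And>k. trop (z k) = (fst (p $ k), u $ k)" by metis
  define x0 where "x0 = (\<chi> k. z k)"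
  have x0: "\<And>k. x0 $ k \<noteq> 0" and trop_x0: "trop_vec x0 = lift u"
    by (simp_all add: x0_def z trop_vec_def lift_def)
  have absv_x0: "absv (trop_vec x0) = u" by (simp add: trop_x0 absv_def lift_def vec_eq_iff)
  have sign_x0: "term_sign ?f (trop_vec x0) l = term_sign ?f p l" for l
    by (simp add: trop_x0 term_sign_def lift_def)
  have val: "term_val ?f u l = real_of_rat (pval (mpoly_term F x0 l))" if "l \<in> ?A" for l
    using term_val_trop_vec[OF that x0] by (simp add: absv_x0)
  obtain k where k: "Poly_Mapping.lookup i k \<noteq> Poly_Mapping.lookup j k"
    using ij(3) by (metis poly_mapping_eqI)
  have "mpoly_term F x0 i > 0" "\<not> mpoly_term F x0 j > 0"
    using signs term_sign_trop_vec[OF ij_A(1) x0] term_sign_trop_vec[OF ij_A(2) x0]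
    by (auto simp: sign_x0 trop_def split: if_splits)
  then have opp: "pleading (mpoly_term F x0 i) * pleading (mpoly_term F x0 j) < 0"
    using pleading_eq_0_iff[of "mpoly_term F x0 j"] mpoly_term_nonzero[OF ij_A(2) x0]
    by (simp add: puiseux_pos_iff mult_less_0_iff)
  have tie: "pval (mpoly_term F x0 i) = pval (mpoly_term F x0 j)"
    using u(3) ij_A by (simp add: val)
  have less: "pval (mpoly_term F x0 i) < pval (mpoly_term F x0 l)" if "l \<in> ?A - {i, j}" for l
    using u(4)[OF that] ij_A that by (simp add: val of_rat_less)
  obtain y where y: "y > 0" "pval y = 0"
    "(\<Sum>l\<in>?A. mpoly_term F x0 l * y ^ Poly_Mapping.lookup l k) = 0"
    using puiseux_positive_unit_root[where d = "\<lambda>l. Poly_Mapping.lookup l k",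
        OF finite_keys mpoly_term_nonzero[OF _ x0] ij_A k tie less opp]
    by blast
  define x where "x = (\<chi> m. if m = k then x0 $ m * y else x0 $ m)"
  have x: "x $ m \<noteq> 0" for m using x0 y(1) by (simp add: x_def)
  have "mpoly_term F x l = mpoly_term F x0 l * y ^ Poly_Mapping.lookup l k" for l
  proof -
    have "(\<Prod>m\<in>UNIV. (x $ m) ^ Poly_Mapping.lookup l m) =
        (\<Prod>m\<in>UNIV. (x0 $ m) ^ Poly_Mapping.lookup l m * (if m = k then y ^ Poly_Mapping.lookup l m else 1))"
      by (intro prod.cong) (auto simp: x_def power_mult_distrib)
    then show ?thesis by (simp add: mpoly_term_def prod.distrib)
  qed
  then have "mpoly_eval F x = 0" using y(3) by (simp add: mpoly_eval_eq_sum_terms)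
  moreover have "trop (x $ m) = trop (x0 $ m)" for m
    using x0[of m] y(1,2) by (auto simp: x_def trop_def pval_mult zero_less_mult_iff)
  then have "trop_vec x \<in> V" using u(1) trop_x0 by (simp add: trop_vec_def)
  ultimately show ?thesis using that x by blast
qed

section \<open>Zeros of a principal ideal\<close>

lemma mpoly_eval_add: "mpoly_eval (F + G) x = mpoly_eval F x + mpoly_eval G x"
  unfolding mpoly_eval_def by (rule setsum_keys_plus_distrib) (simp_all add: distrib_right)

lemma mpoly_eval_0: "mpoly_eval 0 x = 0"
  by (simp add: mpoly_eval_def)

lemma mpoly_eval_sum: "mpoly_eval (\<Sum>a\<in>A. F a) x = (\<Sum>a\<in>A. mpoly_eval (F a) x)"
  by (induction A rule: infinite_finite_induct) (simp_all add: mpoly_eval_0 mpoly_eval_add)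

lemma mpoly_eval_single:
  "mpoly_eval (Poly_Mapping.single l c) x = c * (\<Prod>k\<in>UNIV. (x $ k) ^ Poly_Mapping.lookup l k)"
  by (simp add: mpoly_eval_def)

lemma poly_mapping_sum_single:
  "(\<Sum>l\<in>Poly_Mapping.keys F. Poly_Mapping.single l (Poly_Mapping.lookup F l)) = F"
  by (rule poly_mapping_eqI)
    (simp add: lookup_sum lookup_single when_def in_keys_iff)

lemma mpoly_eval_mult: "mpoly_eval (F * G) x = mpoly_eval F x * mpoly_eval G x"
proof -
  let ?s = "\<lambda>F l. Poly_Mapping.single l (Poly_Mapping.lookup F l) :: 'a pmpoly"
  have "F * G = (\<Sum>l\<in>Poly_Mapping.keys F. \<Sum>m\<in>Poly_Mapping.keys G. ?s F l * ?s G m)"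
    by (subst poly_mapping_sum_single[of F, symmetric], subst poly_mapping_sum_single[of G, symmetric])
      (simp only: sum_product)
  moreover have "mpoly_eval (?s F l * ?s G m) x = mpoly_eval (?s F l) x * mpoly_eval (?s G m) x" for l m
    by (simp add: mult_single mpoly_eval_single lookup_add power_add prod.distrib mult_ac)
  ultimately have "mpoly_eval (F * G) x =
      (\<Sum>l\<in>Poly_Mapping.keys F. mpoly_eval (?s F l) x) * (\<Sum>m\<in>Poly_Mapping.keys G. mpoly_eval (?s G m) x)"
    by (simp only: mpoly_eval_sum sum_product)
  then show ?thesis by (simp only: mpoly_eval_sum[symmetric] poly_mapping_sum_single)
qed

lemma zero_locus_ideal_gen_singleton: "zero_locus (ideal_gen {F}) = zero_locus {F}"
proof -
  have "ideal_gen {F} = range (\<lambda>G. G * F)"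
    unfolding ideal_gen_def by (rule module.span_singleton[OF module_mult])
  then show ?thesis
    by (auto simp: zero_locus_def mpoly_eval_mult)
qed

theorem theorem3p10:
  fixes F :: "('n::finite \<Rightarrow>\<^sub>0 nat) \<Rightarrow>\<^sub>0 puiseux"
  assumes "F \<noteq> 0"
    and "is_triangulation (dual_subdivision (trop_poly F))"
    and "\<forall>l\<in>Poly_Mapping.keys F. {l} \<in> dual_subdivision (trop_poly F)"
  shows "real_tropical_basis {F} (ideal_gen {F})
    \<and> real_trop_hypersurface F = trop_set (zero_locus {F})"
proof -
  have "real_trop_hypersurface F = trop_set (zero_locus {F})"
  proof (rule equalityI)
    show "trop_set (zero_locus {F}) \<subseteq> real_trop_hypersurface F"
      unfolding trop_set_def
      by (rule closure_of_minimal[OF _ closedin_hypersurface])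
        (auto simp: zero_locus_def intro: trop_vec_in_hypersurface[OF assms(1)])
    show "real_trop_hypersurface F \<subseteq> trop_set (zero_locus {F})"
    proof
      fix p assume p: "p \<in> real_trop_hypersurface F"
      then have "p \<in> TRn" by (simp add: real_trop_hypersurface_def Let_def)
      moreover have "\<exists>q. q \<in> trop_vec ` (zero_locus {F} \<inter> {x. \<forall>k. x $ k \<noteq> 0}) \<and> q \<in> U"
        if U: "p \<in> U" "openin (top_of_set TRn) U" for U
      proof -
        obtain V where V: "open V" "U = TRn \<inter> V" using U(2) by (auto simp: openin_open)
        then obtain x where "mpoly_eval F x = 0" "\<And>k. x $ k \<noteq> 0" "trop_vec x \<in> V"
          using exists_zero_near_hypersurface_point[OF assms(2) p, of V] U(1) by blast
        moreover have "trop_vec x \<in> TRn"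
          using fst_trop by (auto simp: TRn_def trop_vec_def mem_Times_iff)
        ultimately show ?thesis by (auto simp: zero_locus_def V)
      qed
      ultimately show "p \<in> trop_set (zero_locus {F})"
        by (auto simp: trop_set_def in_closure_of)
    qed
  qed
  then show ?thesis
    by (auto simp: real_tropical_basis_def zero_locus_ideal_gen_singleton
        real_trop_hypersurface_def Let_def)
qed

end
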